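(* Let $CD$ be the Cantor dust and $\{\phi_n\}$ the approximating combinatorial integration on $CD$. For any functions $f\in C(CD)$ and $g,h\in C^{\mathrm{Lip}}(CD)$, the sequence $\{\phi_n(f,g,h)\}$ converges to $0$ as $n\to\infty$.
   Context: Cantor dust. Let $I=[0,1]\times[0,1]$, $S=\{1,2,3,4\}$, and let $f_s: I\to I$ be $f_1(x)=\frac13 x$, $f_2(x)=\frac13 x+\frac13(0,2)$, $f_3(x)=\frac13 x+\frac13(2,0)$, $f_4(x)=\frac13x+\frac13(2,2)$. The Cantor dust $CD$ is the unique non-empty compact subset of $I$ with $CD=\bigcup_{s=1}^4 f_s(CD)$. For $\boldsymbol{s}=(s_1,\dots,s_n)\in S^{\times n}$ put $f_{\boldsymbol{s}}=f_{s_1}\circ\cdots\circ f_{s_n}$. The square $f_{\boldsymbol{s}}(I)$ has edge length $e=3^{-n}$, and its vertices, which lie in $CD$, are numbered counterclockwise: $0$ = lower left, $1$ = lower right, $2$ = upper right, $3$ = upper left (i.e. $i$ denotes $f_{\boldsymbol{s}}(v_i)$ with $v_0=(0,0)$, $v_1=(1,0)$, $v_2=(1,1)$, $v_3=(0,1)$). Combinatorial Fredholm module. For each $\boldsymbol{s}\in S^{\times n}$ let $\mathcal{H}_{\boldsymbol{s}}=\ell^2$ of the four vertices of $f_{\boldsymbol{s}}(I)$, with the ordered basis corresponding to the vertices $(0,2,1,3)$. A function $f\in C(CD)$ acts on $\mathcal{H}_{\boldsymbol{s}}$ by multiplication, i.e. as the diagonal matrix $\mathrm{diag}(f(0),f(2),f(1),f(3))$.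 In the same basis put \[ F=\frac{1}{\sqrt2}\begin{bmatrix}0&0&1&1\\0&0&-1&1\\1&-1&0&0\\1&1&0&0\end{bmatrix},\qquad M=-\frac{2}{e^2}[F,x][F,y]=\begin{bmatrix}0&1&0&0\\-1&0&0&0\\0&0&0&1\\0&0&-1&0\end{bmatrix}, \] where $x,y$ are the coordinate functions of $\mathbb{R}^2$. Approximating combinatorial integration. For $n\in\mathbb{N}$ and $f,g,h\in C(CD)$, \[ \phi_n(f,g,h)=\sum_{\boldsymbol{s}\in S^{\times n}}\operatorname{Tr}\bigl(f[F,g][F,h]M\bigr), \] where the summand indexed by $\boldsymbol{s}$ is the trace of the operator on $\mathcal{H}_{\boldsymbol{s}}$. $C(CD)$ denotes the continuous complex-valued functions on $CD$ and $C^{\mathrm{Lip}}(CD)$ those that are Lipschitz with respect to the Euclidean metric. *)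

theory Defs
  imports "HOL-Analysis.Analysis"
begin

section \<open>The Cantor dust\<close>

definition unit_square :: "(real \<times> real) set" where
  "unit_square = {0..1} \<times> {0..1}"

definition dust_shift :: "nat \<Rightarrow> real \<times> real" where
  "dust_shift s =
     (if s = 2 then (0, 2) else if s = 3 then (2, 0) else if s = 4 then (2, 2) else (0, 0))"

definition dust_map :: "nat \<Rightarrow> real \<times> real \<Rightarrow> real \<times> real" where
  "dust_map s p = (1/3) *\<^sub>R p + (1/3) *\<^sub>R dust_shift s"

definition is_cantor_dust :: "(real \<times> real) set \<Rightarrow> bool" where
  "is_cantor_dust K \<longleftrightarrow>
     compact K \<and> K \<noteq> {} \<and> K \<subseteq> unit_square \<and> K = (\<Union>s\<in>{1..4}. dust_map s ` K)"

text \<open>By \<open>ex1_cantor_dust\<close> below there is exactly one such set.\<close>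

definition cantor_dust :: "(real \<times> real) set" where
  "cantor_dust = (THE K. is_cantor_dust K)"

definition dust_words :: "nat \<Rightarrow> nat list set" where
  "dust_words n = {s. length s = n \<and> set s \<subseteq> {1..4}}"

text \<open>The map of a word \<open>[s\<^sub>1, \<dots>, s\<^sub>n]\<close> is \<open>f\<^bsub>s\<^sub>1\<^esub> \<circ> \<dots> \<circ> f\<^bsub>s\<^sub>n\<^esub>\<close>.\<close>

definition word_map :: "nat list \<Rightarrow> real \<times> real \<Rightarrow> real \<times> real" where
  "word_map s = foldr (\<lambda>a g. dust_map a \<circ> g) s id"

definition edge :: "nat list \<Rightarrow> real" where
  "edge s = (1/3) ^ length s"

text \<open>Vertices \<open>0, 1, 2, 3\<close> of a square are numbered counterclockwise from the lower left one.\<close>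

definition word_vertex :: "nat list \<Rightarrow> nat \<Rightarrow> real \<times> real" where
  "word_vertex s i = word_map s ([(0, 0), (1, 0), (1, 1), (0, 1)] ! i)"


section \<open>The combinatorial Fredholm module\<close>

text \<open>
  Operators on the four-dimensional space attached to a word are written as matrices in the basis
  of point masses at the vertices, taken in the order \<open>0, 2, 1, 3\<close>.
\<close>

definition act :: "nat list \<Rightarrow> (real \<times> real \<Rightarrow> complex) \<Rightarrow> complex^4^4" where
  "act s f = (\<chi> i j. if i = j
     then vector [f (word_vertex s 0), f (word_vertex s 2),
                  f (word_vertex s 1), f (word_vertex s 3)] $ i
     else 0)"

definition F_op :: "complex^4^4" where
  "F_op = (1 / sqrt 2) *\<^sub>R vector
     [vector [0,  0,  1, 1],
      vector [0,  0, -1, 1],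
      vector [1, -1,  0, 0],
      vector [1,  1,  0, 0]]"

definition commutator :: "complex^4^4 \<Rightarrow> complex^4^4 \<Rightarrow> complex^4^4" where
  "commutator A B = A ** B - B ** A"

definition M_op :: "nat list \<Rightarrow> complex^4^4" where
  "M_op s = (- 2 / (edge s)\<^sup>2) *\<^sub>R
     (commutator F_op (act s (\<lambda>p. of_real (fst p))) **
      commutator F_op (act s (\<lambda>p. of_real (snd p))))"

definition phi ::
  "nat \<Rightarrow> (real \<times> real \<Rightarrow> complex) \<Rightarrow> (real \<times> real \<Rightarrow> complex) \<Rightarrow> (real \<times> real \<Rightarrow> complex) \<Rightarrow> complex"
where
  "phi n f g h = (\<Sum>s\<in>dust_words n.
     trace (act s f ** commutator F_op (act s g) ** commutator F_op (act s h) ** M_op s))"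


section \<open>Existence and uniqueness of the Cantor dust\<close>

definition dust_step :: "(real \<times> real) set \<Rightarrow> (real \<times> real) set" where
  "dust_step K = (\<Union>s\<in>{1..4}. dust_map s ` K)"

lemma mem_dust_step: "x \<in> dust_step K \<longleftrightarrow> (\<exists>s\<in>{1..4}. \<exists>p\<in>K. x = dust_map s p)"
  unfolding dust_step_def by blast

lemma dust_step_mono: "A \<subseteq> B \<Longrightarrow> dust_step A \<subseteq> dust_step B"
  unfolding dust_step_def by blast

lemma dust_step_unit_square: "dust_step unit_square \<subseteq> unit_square"
  unfolding dust_step_def unit_square_def dust_map_def dust_shift_def
  by (auto split: if_splits)

lemma dust_iter_Suc_subset:
  "(dust_step ^^ Suc n) unit_square \<subseteq> (dust_step ^^ n) unit_square"
  by (induction n) (simp_all add: dust_step_unit_square dust_step_mono)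

lemma dust_iter_antimono:
  "m \<le> n \<Longrightarrow> (dust_step ^^ n) unit_square \<subseteq> (dust_step ^^ m) unit_square"
  by (rule lift_Suc_antimono_le[of "\<lambda>n. (dust_step ^^ n) unit_square"])
     (rule dust_iter_Suc_subset)

lemma dust_map_inj: "dust_map s p = dust_map s q \<Longrightarrow> p = q"
  unfolding dust_map_def by simp

lemma dist_dust_map: "dist (dust_map s p) (dust_map s q) = dist p q / 3"
  unfolding dust_map_def dist_norm
  by (simp add: scaleR_diff_right[symmetric] del: scaleR_diff_right)

lemma compact_dust_step: "compact K \<Longrightarrow> compact (dust_step K)"
  unfolding dust_step_def dust_map_def
  by (intro compact_UN compact_continuous_image continuous_intros) auto

definition dust_limit :: "(real \<times> real) set" where
  "dust_limit = (\<Inter>n. (dust_step ^^ n) unit_square)"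

lemma dust_step_limit: "dust_step dust_limit = dust_limit"
proof
  show "dust_step dust_limit \<subseteq> dust_limit"
  proof
    fix x assume x: "x \<in> dust_step dust_limit"
    have "x \<in> (dust_step ^^ n) unit_square" for n
    proof -
      have "dust_limit \<subseteq> (dust_step ^^ n) unit_square"
        unfolding dust_limit_def by blast
      from dust_step_mono[OF this] x have "x \<in> (dust_step ^^ Suc n) unit_square" by auto
      then show ?thesis using dust_iter_Suc_subset by blast
    qed
    then show "x \<in> dust_limit" unfolding dust_limit_def by blast
  qed
next
  show "dust_limit \<subseteq> dust_step dust_limit"
  proof
    fix x assume x: "x \<in> dust_limit"
    show "x \<in> dust_step dust_limit"
    proof (rule ccontr)
      assume nx: "x \<notin> dust_step dust_limit"
      have "\<exists>n. x \<notin> dust_map s ` ((dust_step ^^ n) unit_square)" if s: "s \<in> {1..4}" for s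
      proof (rule ccontr)
        assume "\<nexists>n. x \<notin> dust_map s ` ((dust_step ^^ n) unit_square)"
        then have all: "\<And>n. x \<in> dust_map s ` ((dust_step ^^ n) unit_square)" by blast
        from all[of 0] obtain p where p: "x = dust_map s p" by blast
        have "p \<in> (dust_step ^^ n) unit_square" for n
          using all[of n] p dust_map_inj by blast
        then have "p \<in> dust_limit" unfolding dust_limit_def by blast
        with p s nx show False unfolding dust_step_def by blast
      qed
      then obtain N where
        N: "\<And>s. s \<in> {1..4} \<Longrightarrow> x \<notin> dust_map s ` ((dust_step ^^ N s) unit_square)"
        by metis
      define m where "m = Max (N ` {1..4})"
      have "x \<notin> dust_map s ` ((dust_step ^^ m) unit_square)" if s: "s \<in> {1..4}" for s
      proof -
        have "N s \<le> m" unfolding m_def using s by (intro Max_ge) auto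
        then show ?thesis using N[OF s] dust_iter_antimono by blast
      qed
      then have "x \<notin> (dust_step ^^ Suc m) unit_square"
        by (auto simp: dust_step_def)
      then show False using x unfolding dust_limit_def by blast
    qed
  qed
qed

lemma is_cantor_dust_limit: "is_cantor_dust dust_limit"
proof -
  have c: "compact ((dust_step ^^ n) unit_square)" for n
    by (induction n) (auto simp: unit_square_def compact_Times compact_dust_step)
  have ne: "(dust_step ^^ n) unit_square \<noteq> {}" for n
    by (induction n) (auto simp: unit_square_def dust_step_def)
  have "dust_limit \<noteq> {}"
    unfolding dust_limit_def by (rule compact_nest[OF c ne dust_iter_antimono])
  moreover have "compact dust_limit"
    unfolding dust_limit_def by (rule compact_Inter) (use c in auto)
  moreover have "dust_limit \<subseteq> unit_square"
    unfolding dust_limit_def by (metis INT_lower UNIV_I funpow_0)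
  ultimately show ?thesis
    unfolding is_cantor_dust_def using dust_step_limit unfolding dust_step_def by blast
qed

lemma is_cantor_dust_unique:
  assumes "is_cantor_dust K"
  shows "K = dust_limit"
proof
  have K: "compact K" "K \<noteq> {}" "K \<subseteq> unit_square" "dust_step K = K"
    using assms unfolding is_cantor_dust_def dust_step_def by auto
  have "K \<subseteq> (dust_step ^^ n) unit_square" for n
  proof (induction n)
    case (Suc n)
    from dust_step_mono[OF this] K(4) show ?case by simp
  qed (simp add: K(3))
  then show "K \<subseteq> dust_limit" unfolding dust_limit_def by blast
  have near: "\<exists>k\<in>K. dist x k \<le> 2 * (1/3) ^ n" if "x \<in> (dust_step ^^ n) unit_square" for x n
    using that
  proof (induction n arbitrary: x)
    case 0
    obtain k where k: "k \<in> K" using K(2) by blast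
    then have ki: "k \<in> unit_square" using K(3) by blast
    have "dist x k \<le> dist (fst x) (fst k) + dist (snd x) (snd k)"
      unfolding dist_prod_def by (rule sqrt_sum_squares_le_sum) auto
    also have "\<dots> \<le> 2"
      using 0 ki unfolding unit_square_def by (auto simp: dist_real_def)
    finally show ?case using k by auto
  next
    case (Suc n)
    have "x \<in> dust_step ((dust_step ^^ n) unit_square)" using Suc.prems by simp
    then obtain s p where s:
      "s \<in> {1..4}" "p \<in> (dust_step ^^ n) unit_square" "x = dust_map s p"
      unfolding mem_dust_step by metis
    from Suc.IH[OF s(2)] obtain k where k: "k \<in> K" "dist p k \<le> 2 * (1/3) ^ n" by blast
    have "dust_map s k \<in> K" using K(4) k(1) s(1) unfolding dust_step_def by blast
    moreover have "dist x (dust_map s k) \<le> 2 * (1/3) ^ Suc n"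
      using k(2) by (simp add: s(3) dist_dust_map)
    ultimately show ?case by blast
  qed
  show "dust_limit \<subseteq> K"
  proof
    fix x assume x: "x \<in> dust_limit"
    have "x \<in> closure K"
      unfolding closure_approachable
    proof (intro allI impI)
      fix e :: real assume e: "0 < e"
      then obtain n where n: "(1/3) ^ n < e / 2"
        using real_arch_pow_inv[of "e / 2" "1/3"] by auto
      from x have "x \<in> (dust_step ^^ n) unit_square" unfolding dust_limit_def by blast
      from near[OF this] obtain k where "k \<in> K" "dist x k \<le> 2 * (1/3) ^ n" by blast
      then show "\<exists>k\<in>K. dist k x < e" using n by (auto simp: dist_commute intro!: bexI[of _ k])
    qed
    then show "x \<in> K" using compact_imp_closed[OF K(1)] by simp
  qed
qed

theorem ex1_cantor_dust: "\<exists>!K. is_cantor_dust K"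
  using is_cantor_dust_limit is_cantor_dust_unique by blast

corollary is_cantor_dust_cantor_dust: "is_cantor_dust cantor_dust"
  unfolding cantor_dust_def by (rule theI'[OF ex1_cantor_dust])


section \<open>The explicit form of the matrix \<open>M\<close>\<close>

lemma word_map_Nil: "word_map [] p = p"
  unfolding word_map_def by simp

lemma word_map_Cons: "word_map (a # s) p = dust_map a (word_map s p)"
  unfolding word_map_def by simp

lemma word_map_eq: "word_map s p = word_map s 0 + edge s *\<^sub>R p"
proof (induction s)
  case (Cons a s)
  have "word_map (a # s) p = dust_map a (word_map s 0 + edge s *\<^sub>R p)"
    unfolding word_map_Cons Cons.IH ..
  also have "\<dots> = word_map (a # s) 0 + edge (a # s) *\<^sub>R p"
    unfolding word_map_Cons dust_map_def by (simp add: edge_def scaleR_add_right)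
  finally show ?case .
qed (simp add: word_map_Nil edge_def)

lemma vector_4_nth:
  "(vector [a, b, c, d] :: 'a::zero^4) $ 1 = a"
  "(vector [a, b, c, d] :: 'a::zero^4) $ 2 = b"
  "(vector [a, b, c, d] :: 'a::zero^4) $ 3 = c"
  "(vector [a, b, c, d] :: 'a::zero^4) $ 4 = d"
  unfolding vector_def by simp_all

lemma commutator_F_op_act:
  fixes s f
  defines "a \<equiv> f (word_vertex s 0)" and "b \<equiv> f (word_vertex s 1)"
    and "c \<equiv> f (word_vertex s 2)" and "d \<equiv> f (word_vertex s 3)"
  shows "commutator F_op (act s f) = (1 / sqrt 2) *\<^sub>R vector
     [vector [0,     0,     b - a, d - a],
      vector [0,     0,     c - b, d - c],
      vector [a - b, b - c, 0,     0],
      vector [a - d, c - d, 0,     0]]"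
  unfolding vec_eq_iff forall_4 commutator_def matrix_matrix_mult_def F_op_def act_def
    a_def[symmetric] b_def[symmetric] c_def[symmetric] d_def[symmetric]
  by (simp add: sum_4 vector_4_nth scaleR_right_diff_distrib)

theorem M_op_eq:
  "M_op s = vector
     [vector [ 0, 1,  0, 0],
      vector [-1, 0,  0, 0],
      vector [ 0, 0,  0, 1],
      vector [ 0, 0, -1, 0]]"
proof -
  have e: "edge s \<noteq> 0" by (simp add: edge_def)
  define w where "w = word_map s 0"
  have v: "word_vertex s 0 = w" "word_vertex s 1 = w + edge s *\<^sub>R (1, 0)"
    "word_vertex s 2 = w + edge s *\<^sub>R (1, 1)" "word_vertex s 3 = w + edge s *\<^sub>R (0, 1)"
    unfolding word_vertex_def w_def by (subst word_map_eq; simp add: zero_prod_def[symmetric])+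
  have "(1 / (edge s)\<^sup>2) *\<^sub>R (complex_of_real (edge s) * complex_of_real (edge s)) = 1"
    using e by (simp add: scaleR_conv_of_real power2_eq_square)
  then show ?thesis
    unfolding M_op_def commutator_F_op_act v vec_eq_iff forall_4 matrix_matrix_mult_def
    by (simp add: sum_4 vector_4_nth)
qed

end

theory Submission
  imports Defs
begin

text \<open>
  The convergence is a matter of counting, with no cancellation. There are \<open>4 ^ n\<close> squares of
  level \<open>n\<close>, each of edge length \<open>3 powi (- n)\<close>. An entry of \<open>[F, g]\<close> is a multiple of the increment
  of \<open>g\<close> along an edge, because \<open>F\<close> vanishes between the two ends of a diagonal. For Lipschitz
  \<open>g\<close> and \<open>h\<close>, and since \<open>f\<close> and \<open>M\<close> are bounded, each trace is therefore of order
  \<open>9 powi (- n)\<close>, uniformly in the word, and the sum is of order \<open>(4/9) ^ n\<close>. In other words,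
  the dust has dimension \<open>log 3 4 < 2\<close>, so it does not carry a quantity that scales
  like an area.

  The Lipschitz and boundedness hypotheses hold on the dust only, so the estimates also
  need the vertices of all the squares to lie in it (\<open>word_vertex_in_cantor_dust\<close>). The estimate
  for a single square is \<open>norm_phi_summand_le\<close>.
\<close>

lemma dust_map_in_cantor_dust:
  assumes "a \<in> {1..4}" "p \<in> cantor_dust"
  shows "dust_map a p \<in> cantor_dust"
  using assms is_cantor_dust_cantor_dust unfolding is_cantor_dust_def by blast

lemma word_map_in_cantor_dust:
  assumes "set s \<subseteq> {1..4}" "p \<in> cantor_dust"
  shows "word_map s p \<in> cantor_dust"
  using assms by (induction s) (auto simp: word_map_Nil word_map_Cons dust_map_in_cantor_dust)

lemma cantor_dust_eq_dust_limit: "cantor_dust = dust_limit"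
  by (rule is_cantor_dust_unique[OF is_cantor_dust_cantor_dust])

text \<open>A fixed point of one of the maps survives every step of the iteration from the square.\<close>

lemma fixed_point_in_cantor_dust:
  assumes a: "a \<in> {1..4}" and p: "p \<in> unit_square" and fixed: "dust_map a p = p"
  shows "p \<in> cantor_dust"
proof -
  have "p \<in> (dust_step ^^ n) unit_square" for n
  proof (induction n)
    case (Suc n)
    then have "\<exists>s\<in>{1..4}. \<exists>q\<in>(dust_step ^^ n) unit_square. p = dust_map s q"
      using a fixed by metis
    then show ?case by (simp add: mem_dust_step)
  qed (simp add: p)
  then show ?thesis unfolding cantor_dust_eq_dust_limit dust_limit_def by blast
qed

lemma corners_in_cantor_dust:
  "(0, 0) \<in> cantor_dust" "(1, 0) \<in> cantor_dust" "(1, 1) \<in> cantor_dust" "(0, 1) \<in> cantor_dust"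
proof -
  show "(0, 0) \<in> cantor_dust"
    by (rule fixed_point_in_cantor_dust[of 1]) (auto simp: unit_square_def dust_map_def dust_shift_def)
  show "(1, 0) \<in> cantor_dust"
    by (rule fixed_point_in_cantor_dust[of 3]) (auto simp: unit_square_def dust_map_def dust_shift_def)
  show "(1, 1) \<in> cantor_dust"
    by (rule fixed_point_in_cantor_dust[of 4]) (auto simp: unit_square_def dust_map_def dust_shift_def)
  show "(0, 1) \<in> cantor_dust"
    by (rule fixed_point_in_cantor_dust[of 2]) (auto simp: unit_square_def dust_map_def dust_shift_def)
qed

lemma word_vertex_in_cantor_dust:
  assumes "set s \<subseteq> {1..4}" "i < 4"
  shows "word_vertex s i \<in> cantor_dust"
proof -
  have "i = 0 \<or> i = 1 \<or> i = 2 \<or> i = 3" using assms(2) by linarith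
  then have "[(0, 0), (1, 0), (1, 1), (0, 1)] ! i \<in> cantor_dust"
    using corners_in_cantor_dust by auto
  then show ?thesis unfolding word_vertex_def by (rule word_map_in_cantor_dust[OF assms(1)])
qed

lemma dist_word_map: "dist (word_map s p) (word_map s q) = edge s * dist p q"
proof -
  have "word_map s p - word_map s q = edge s *\<^sub>R (p - q)"
    by (subst (1 2) word_map_eq) (simp add: scaleR_diff_right)
  then show ?thesis by (simp add: dist_norm edge_def)
qed

lemma dist_adjacent_word_vertices:
  "dist (word_vertex s 0) (word_vertex s 1) = edge s"
  "dist (word_vertex s 1) (word_vertex s 2) = edge s"
  "dist (word_vertex s 2) (word_vertex s 3) = edge s"
  "dist (word_vertex s 0) (word_vertex s 3) = edge s"
  unfolding word_vertex_def by (simp_all add: dist_word_map dist_Pair_Pair)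

lemma norm_act_nth_le:
  assumes s: "set s \<subseteq> {1..4}" and C: "\<And>p. p \<in> cantor_dust \<Longrightarrow> norm (f p) \<le> C"
  shows "norm (act s f $ i $ j) \<le> C"
proof -
  have v: "norm (f (word_vertex s k)) \<le> C" if "k < 4" for k
    using C word_vertex_in_cantor_dust[OF s that] by blast
  have "0 \<le> C" by (rule order_trans[OF norm_ge_zero v[of 0]]) simp
  moreover have "\<forall>i. norm (vector [f (word_vertex s 0), f (word_vertex s 2),
      f (word_vertex s 1), f (word_vertex s 3)] $ (i :: 4)) \<le> C"
    unfolding forall_4 vector_4_nth by (intro conjI v) simp_all
  ultimately show ?thesis unfolding act_def by simp
qed

text \<open>
  Every nonzero entry compares values at two adjacent vertices, at distance \<open>edge s\<close>; the factor
  \<open>1 / sqrt 2\<close> of \<open>F\<close> is bounded by \<open>1\<close>.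
\<close>

lemma norm_commutator_F_op_act_nth_le:
  assumes s: "set s \<subseteq> {1..4}" and g: "L-lipschitz_on cantor_dust g"
  shows "norm (commutator F_op (act s g) $ i $ j) \<le> L * edge s"
proof -
  have v: "word_vertex s k \<in> cantor_dust" if "k < 4" for k
    using word_vertex_in_cantor_dust[OF s that] .
  have e: "norm (g (word_vertex s k) - g (word_vertex s l)) \<le> L * edge s"
    if "k < 4" "l < 4" "dist (word_vertex s k) (word_vertex s l) = edge s" for k l
    using lipschitz_onD[OF g v[OF that(1)] v[OF that(2)]] that(3) by (simp add: dist_norm)
  have e4:
    "norm (g (word_vertex s 0) - g (word_vertex s 1)) \<le> L * edge s"
    "norm (g (word_vertex s 1) - g (word_vertex s 2)) \<le> L * edge s"
    "norm (g (word_vertex s 2) - g (word_vertex s 3)) \<le> L * edge s"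
    "norm (g (word_vertex s 0) - g (word_vertex s 3)) \<le> L * edge s"
    by (rule e; simp only: dist_adjacent_word_vertices; simp)+
  have nn: "0 \<le> L * edge s" using e4(1) norm_ge_zero order_trans by blast
  have scaled: "x / sqrt 2 \<le> L * edge s" if "x \<le> L * edge s" for x
  proof -
    have "x / sqrt 2 \<le> L * edge s / sqrt 2" using that by (simp add: divide_right_mono)
    also have "\<dots> \<le> L * edge s / 1" by (rule divide_left_mono) (use nn in auto)
    finally show ?thesis by simp
  qed
  have "\<forall>i j. norm (commutator F_op (act s g) $ i $ j) \<le> L * edge s"
    unfolding forall_4 commutator_F_op_act
    using nn e4[THEN scaled] by (simp add: vector_4_nth norm_minus_commute)
  then show ?thesis by blast
qed

lemma norm_M_op_nth_le: "norm (M_op s $ i $ j) \<le> 1"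
proof -
  have "\<forall>i j. norm (M_op s $ i $ j) \<le> 1"
    unfolding forall_4 M_op_eq by (simp add: vector_4_nth)
  then show ?thesis by blast
qed

lemma norm_matrix_mult_nth_le:
  fixes A :: "'a::real_normed_algebra_1^'n^'m" and B :: "'a^'k^'n" and a b :: real
  assumes "\<And>i j. norm (A $ i $ j) \<le> a" "\<And>i j. norm (B $ i $ j) \<le> b"
  shows "norm ((A ** B) $ i $ j) \<le> CARD('n) * (a * b)"
proof -
  have a: "0 \<le> a" using assms(1) norm_ge_zero order_trans by blast
  have "norm ((A ** B) $ i $ j) \<le> (\<Sum>k\<in>UNIV. norm (A $ i $ k * B $ k $ j))"
    unfolding matrix_matrix_mult_def by (simp add: norm_sum)
  also have "\<dots> \<le> (\<Sum>k\<in>(UNIV::'n set). a * b)"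
    by (intro sum_mono order_trans[OF norm_mult_ineq] mult_mono assms a norm_ge_zero)
  finally show ?thesis by simp
qed

lemma norm_trace_le:
  fixes A :: "'a::real_normed_algebra_1^'n^'n" and a :: real
  assumes "\<And>i. norm (A $ i $ i) \<le> a"
  shows "norm (trace A) \<le> CARD('n) * a"
  unfolding trace_def using sum_norm_le[of UNIV "\<lambda>i. A $ i $ i" "\<lambda>_. a"] assms by simp

text \<open>The constant \<open>256\<close> is \<open>4 ^ 4\<close>: a factor \<open>4\<close>, the dimension, for each of the three products and for the trace.\<close>

lemma norm_phi_summand_le:
  assumes s: "set s \<subseteq> {1..4}"
    and f: "\<And>p. p \<in> cantor_dust \<Longrightarrow> norm (f p) \<le> C"
    and g: "L-lipschitz_on cantor_dust g" and h: "K-lipschitz_on cantor_dust h"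
  shows "norm (trace (act s f ** commutator F_op (act s g) ** commutator F_op (act s h) ** M_op s))
    \<le> 256 * C * L * K * (1/9) ^ length s"
proof -
  have "norm (trace (act s f ** commutator F_op (act s g) ** commutator F_op (act s h) ** M_op s))
      \<le> CARD(4) * (CARD(4) * ((CARD(4) * ((CARD(4) * (C * (L * edge s))) * (K * edge s))) * 1))"
    by (intro norm_trace_le norm_matrix_mult_nth_le norm_act_nth_le[OF s f]
        norm_commutator_F_op_act_nth_le[OF s g] norm_commutator_F_op_act_nth_le[OF s h]
        norm_M_op_nth_le)
  also have "\<dots> = 256 * C * L * K * (edge s * edge s)" by simp
  also have "edge s * edge s = (1/9) ^ length s"
    unfolding edge_def by (simp add: power_mult_distrib[symmetric])
  finally show ?thesis .
qed

lemma card_dust_words: "card (dust_words n) = 4 ^ n"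
  using card_lists_length_eq[of "{1..4::nat}" n] by (simp add: dust_words_def conj_commute)

theorem proposition3p3:
  fixes f g h :: "real \<times> real \<Rightarrow> complex"
  assumes "continuous_on cantor_dust f"
    and "\<exists>L. L-lipschitz_on cantor_dust g"
    and "\<exists>L. L-lipschitz_on cantor_dust h"
  shows "(\<lambda>n. phi n f g h) \<longlonglongrightarrow> 0"
proof -
  obtain L K where g: "L-lipschitz_on cantor_dust g" and h: "K-lipschitz_on cantor_dust h"
    using assms(2,3) by blast
  have "compact cantor_dust"
    using is_cantor_dust_cantor_dust unfolding is_cantor_dust_def by blast
  then have "bounded (f ` cantor_dust)"
    using assms(1) compact_continuous_image compact_imp_bounded by blast
  then obtain C where f: "\<And>p. p \<in> cantor_dust \<Longrightarrow> norm (f p) \<le> C"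
    unfolding bounded_iff by blast
  have bound: "norm (phi n f g h) \<le> 256 * C * L * K * (4/9) ^ n" for n
  proof -
    have "norm (phi n f g h) \<le> (\<Sum>s\<in>dust_words n. 256 * C * L * K * (1/9) ^ n)"
      unfolding phi_def
    proof (rule sum_norm_le)
      fix s assume "s \<in> dust_words n"
      then have s: "set s \<subseteq> {1..4}" "length s = n" by (auto simp: dust_words_def)
      show "norm (trace (act s f ** commutator F_op (act s g) ** commutator F_op (act s h) ** M_op s))
          \<le> 256 * C * L * K * (1/9) ^ n"
        using norm_phi_summand_le[OF s(1) f g h] s(2) by simp
    qed
    also have "\<dots> = 256 * C * L * K * (4/9) ^ n"
      by (simp add: card_dust_words power_divide)
    finally show ?thesis .
  qed
  have "(\<lambda>n. 256 * C * L * K * (4/9) ^ n) \<longlonglongrightarrow> 0"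
    by (intro tendsto_mult_right_zero LIMSEQ_power_zero) simp
  with always_eventually[OF allI, OF bound] show ?thesis by (rule Lim_null_comparison)
qed

end
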